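(* Let $\mathcal{D}=\{D_1,\dots,D_k\}$ be a dataset of finite sets of objects with $|D_i|=|D_j|$ for all $i,j\in\{1,\dots,k\}$. Let the cost function $c$ between the objects of $\bigcup_i D_i$ be given by $c(a,b)=d_{(T,w)}(\varrho(a),\varrho(b))$, where $T$ is a finite tree with edge weights $w:E(T)\to\mathbb{R}_{>0}$ and $\varrho:\bigcup_i D_i\to V(T)$ is a map. Let $$\phi_c:\mathcal{D}\to\mathbb{R}^{E(T)},\qquad \phi_c(A)=\left[A_{\overleftarrow{uv}}\cdot w(uv)\right]_{uv\in E(T)}.$$ Then for all $A,B\in\mathcal{D}$, $$D^c_{\mathrm{OA}}(A,B)=\left\lVert \phi_c(A)-\phi_c(B)\right\rVert_1 .$$
   Context: For $x,y\in V(T)$, $d_{(T,w)}(x,y)=\sum_{e\in P(x,y)}w(e)$, where $P(x,y)$ is the unique path from $x$ to $y$ in $T$. For each edge of $T$ fix once and for all an ordering of its endpoints, writing the edge as $uv$. Deleting the edge $uv$ from $T$ yields two connected components, one containing $u$ and the other containing $v$. For a finite set $A$ of objects, $A_{\overleftarrow{uv}}$ denotes the number of objects $a\in A$ for which $\varrho(a)$ lies in the component containing $u$. For finite sets $A,B$ with $|A|=|B|$, an assignment is a one-to-one correspondence (bijection) $M\subseteq A\times B$ between $A$ and $B$, its cost is $c(M)=\sum_{(a,b)\in M}c(a,b)$, and $D^c_{\mathrm{OA}}(A,B)$ denotes the minimum of $c(M)$ over all assignments $M$ between $A$ and $B$. $\lVert\cdot\rVert_1$ is the $\ell_1$ (Manhattan)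 norm. *)

theory Defs
  imports Complex_Main "HOL-Library.FuncSet"
begin

text \<open>
  Undirected simple graphs are given by a vertex set \<open>V\<close> and a set \<open>E\<close> of two-element
  subsets of \<open>V\<close>. A walk is the nonempty list of vertices it visits, so a single vertex
  is a walk without edges.
\<close>

definition finite_simple_graph :: "'v set \<Rightarrow> 'v set set \<Rightarrow> bool" where
  "finite_simple_graph V E \<longleftrightarrow>
     finite V \<and> (\<forall>e\<in>E. \<exists>u\<in>V. \<exists>v\<in>V. u \<noteq> v \<and> e = {u, v})"

fun walk_edges :: "'v list \<Rightarrow> 'v set list" where
  "walk_edges [] = []"
| "walk_edges [x] = []"
| "walk_edges (x # y # p) = {x, y} # walk_edges (y # p)"

definition graph_walk :: "'v set \<Rightarrow> 'v set set \<Rightarrow> 'v \<Rightarrow> 'v list \<Rightarrow> 'v \<Rightarrow> bool" where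
  "graph_walk V E x p y \<longleftrightarrow>
     p \<noteq> [] \<and> hd p = x \<and> last p = y \<and> set p \<subseteq> V \<and> set (walk_edges p) \<subseteq> E"

definition graph_path :: "'v set \<Rightarrow> 'v set set \<Rightarrow> 'v \<Rightarrow> 'v list \<Rightarrow> 'v \<Rightarrow> bool" where
  "graph_path V E x p y \<longleftrightarrow> graph_walk V E x p y \<and> distinct p"

text \<open>A cycle is listed without repeating its first vertex at the end.\<close>

definition graph_cycle :: "'v set \<Rightarrow> 'v set set \<Rightarrow> 'v list \<Rightarrow> bool" where
  "graph_cycle V E p \<longleftrightarrow>
     length p \<ge> 3 \<and> distinct p \<and> graph_walk V E (hd p) (p @ [hd p]) (hd p)"

definition graph_connected :: "'v set \<Rightarrow> 'v set set \<Rightarrow> bool" where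
  "graph_connected V E \<longleftrightarrow> V \<noteq> {} \<and> (\<forall>x\<in>V. \<forall>y\<in>V. \<exists>p. graph_walk V E x p y)"

definition finite_tree :: "'v set \<Rightarrow> 'v set set \<Rightarrow> bool" where
  "finite_tree V E \<longleftrightarrow>
     finite_simple_graph V E \<and> graph_connected V E \<and> (\<nexists>p. graph_cycle V E p)"

definition tree_path :: "'v set \<Rightarrow> 'v set set \<Rightarrow> 'v \<Rightarrow> 'v \<Rightarrow> 'v list" where
  "tree_path V E x y = (THE p. graph_path V E x p y)"

definition tree_dist :: "'v set \<Rightarrow> 'v set set \<Rightarrow> ('v set \<Rightarrow> real) \<Rightarrow> 'v \<Rightarrow> 'v \<Rightarrow> real" where
  "tree_dist V E w x y = (\<Sum>e\<in>set (walk_edges (tree_path V E x y)). w e)"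

definition component_of_vertex :: "'v set \<Rightarrow> 'v set set \<Rightarrow> 'v \<Rightarrow> 'v set" where
  "component_of_vertex V E u = {x\<in>V. \<exists>p. graph_walk V E u p x}"

text \<open>An ordering of the endpoints of every edge: \<open>ends e = (u, v)\<close> for \<open>e = {u, v}\<close>.\<close>

definition endpoint_ordering :: "'v set set \<Rightarrow> ('v set \<Rightarrow> 'v \<times> 'v) \<Rightarrow> bool" where
  "endpoint_ordering E ends \<longleftrightarrow> (\<forall>e\<in>E. e = {fst (ends e), snd (ends e)})"

text \<open>The number of objects of \<open>A\<close> on the side of the first endpoint after deleting \<open>e\<close>.\<close>

definition left_count ::
  "'v set \<Rightarrow> 'v set set \<Rightarrow> ('v set \<Rightarrow> 'v \<times> 'v) \<Rightarrow> ('a \<Rightarrow> 'v) \<Rightarrow> 'a set \<Rightarrow> 'v set \<Rightarrow> nat" where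
  "left_count V E ends \<rho> A e =
     card {a\<in>A. \<rho> a \<in> component_of_vertex V (E - {e}) (fst (ends e))}"

text \<open>
  Vectors indexed by the edges are functions on the carrier \<open>E\<close>; \<open>restrict\<close> fixes their
  irrelevant values outside \<open>E\<close>.
\<close>

definition tree_embedding ::
  "'v set \<Rightarrow> 'v set set \<Rightarrow> ('v set \<Rightarrow> real) \<Rightarrow> ('v set \<Rightarrow> 'v \<times> 'v) \<Rightarrow> ('a \<Rightarrow> 'v)
     \<Rightarrow> 'a set \<Rightarrow> ('v set \<Rightarrow> real)" where
  "tree_embedding V E w ends \<rho> A = (\<lambda>e\<in>E. real (left_count V E ends \<rho> A e) * w e)"

definition l1_norm_on :: "'i set \<Rightarrow> ('i \<Rightarrow> real) \<Rightarrow> real" where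
  "l1_norm_on I x = (\<Sum>i\<in>I. \<bar>x i\<bar>)"

definition assignment :: "'a set \<Rightarrow> 'a set \<Rightarrow> ('a \<times> 'a) set \<Rightarrow> bool" where
  "assignment A B M \<longleftrightarrow> (\<exists>f. bij_betw f A B \<and> M = {(a, f a) |a. a \<in> A})"

definition assignment_cost :: "('a \<Rightarrow> 'a \<Rightarrow> real) \<Rightarrow> ('a \<times> 'a) set \<Rightarrow> real" where
  "assignment_cost c M = (\<Sum>(a, b)\<in>M. c a b)"

text \<open>
  Only meaningful for finite \<open>A\<close>, \<open>B\<close> of equal cardinality, where the set of assignments
  is finite and nonempty.
\<close>

definition optimal_assignment_cost :: "('a \<Rightarrow> 'a \<Rightarrow> real) \<Rightarrow> 'a set \<Rightarrow> 'a set \<Rightarrow> real" where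
  "optimal_assignment_cost c A B = Min (assignment_cost c ` {M. assignment A B M})"

end

theory Submission
  imports Defs "HOL-Combinatorics.Transposition"
begin

text \<open>
  Every edge splits the vertices into two sides, and the distance of two vertices is the total
  weight of the edges separating them. Two different edges never cross: one side of the first lies
  entirely on one side of the second. If an optimal assignment moved two objects across the same
  edge in opposite directions, exchanging their partners would save twice the weight of that edge
  and, since edges do not cross, cost nothing on the others. Hence an optimal assignment crosses
  each edge in one direction only, that is, exactly as often as the numbers of objects on its
  first side differ.
\<close>

section \<open>Optimal assignments\<close>

lemma assignment_cost_graph:
  "assignment_cost c {(a, f a) |a. a \<in> A} = (\<Sum>a\<in>A. c a (f a))"
proof -
  have "{(a, f a) |a. a \<in> A} = (\<lambda>a. (a, f a)) ` A"
    by auto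
  then show ?thesis
    unfolding assignment_cost_def by (simp add: sum.reindex inj_on_def)
qed

text \<open>Assignments are subsets of the finite set \<open>A \<times> B\<close>, and equal
  cardinalities supply at least one, so \<open>Min\<close> is a genuine minimum. From here on
  bijections replace sets of pairs.\<close>

lemma optimal_assignment_cost_attained:
  assumes "finite A" "finite B" "card A = card B"
  obtains f where "bij_betw f A B"
    "optimal_assignment_cost c A B = (\<Sum>a\<in>A. c a (f a))"
    "\<And>h. bij_betw h A B \<Longrightarrow> (\<Sum>a\<in>A. c a (f a)) \<le> (\<Sum>a\<in>A. c a (h a))"
proof -
  let ?S = "assignment_cost c ` {M. assignment A B M}"
  have "{M. assignment A B M} \<subseteq> Pow (A \<times> B)"
    by (auto simp: assignment_def bij_betw_def)
  then have fin: "finite ?S"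
    using assms by (meson finite_Pow_iff finite_SigmaI finite_imageI finite_subset)
  have cost_mem: "(\<Sum>a\<in>A. c a (h a)) \<in> ?S" if "bij_betw h A B" for h
    using that by (auto simp: assignment_def simp flip: assignment_cost_graph)
  obtain h where "bij_betw h A B"
    using assms finite_same_card_bij by blast
  then have "?S \<noteq> {}"
    using cost_mem by blast
  with fin have "Min ?S \<in> ?S"
    by (rule Min_in)
  then obtain f where f: "bij_betw f A B" "Min ?S = (\<Sum>a\<in>A. c a (f a))"
    by (auto simp: assignment_def assignment_cost_graph)
  have "(\<Sum>a\<in>A. c a (f a)) \<le> (\<Sum>a\<in>A. c a (h a))" if "bij_betw h A B" for h
    using Min_le[OF fin cost_mem[OF that]] f(2) by simp
  with f show ?thesis
    using that unfolding optimal_assignment_cost_def by blast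
qed

text \<open>Precomposing \<open>f\<close> with the transposition of \<open>a\<close> and
  \<open>a'\<close> yields a competing bijection whose cost differs from that of \<open>f\<close> at
  these two objects alone.\<close>

lemma optimal_bij_exchange:
  fixes c :: "'a \<Rightarrow> 'b \<Rightarrow> real"
  assumes "finite A" and f: "bij_betw f A B" and a: "a \<in> A" "a' \<in> A"
    and opt: "\<And>h. bij_betw h A B \<Longrightarrow> (\<Sum>a\<in>A. c a (f a)) \<le> (\<Sum>a\<in>A. c a (h a))"
  shows "c a (f a) + c a' (f a') \<le> c a (f a') + c a' (f a)"
proof (cases "a = a'")
  case False
  let ?h = "f \<circ> transpose a a'"
  have split: "(\<Sum>x\<in>A. g x) = g a + g a' + (\<Sum>x\<in>A - {a, a'}. g x)" for g :: "'a \<Rightarrow> real"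
    using sum.subset_diff[of "{a, a'}" A g] assms False by simp
  have "bij_betw (transpose a a') A A"
    using a by simp
  then have "bij_betw ?h A B"
    using f by (rule bij_betw_trans)
  then have "(\<Sum>x\<in>A. c x (f x)) \<le> (\<Sum>x\<in>A. c x (?h x))"
    by (rule opt)
  moreover have "(\<Sum>x\<in>A - {a, a'}. c x (?h x)) = (\<Sum>x\<in>A - {a, a'}. c x (f x))"
    by (rule sum.cong) (auto simp: transpose_def)
  ultimately show ?thesis
    by (simp add: split)
qed simp

text \<open>As \<open>f\<close> is a bijection, the signed crossings always sum to the difference of
  the two counts. By \<open>dir\<close> all signed terms have one sign, so absolute values may be
  taken termwise.\<close>

lemma sum_of_bool_neq_one_directional:
  assumes "finite A" and f: "bij_betw f A B"
    and dir: "\<And>a a'. a \<in> A \<Longrightarrow> a' \<in> A \<Longrightarrow> P a \<Longrightarrow> \<not> P (f a) \<Longrightarrow> \<not> P a' \<Longrightarrow> P (f a') \<Longrightarrow> False"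
  shows "(\<Sum>a\<in>A. of_bool (P a \<noteq> P (f a))) = \<bar>real (card {a\<in>A. P a}) - real (card {b\<in>B. P b})\<bar>"
proof -
  let ?d = "\<lambda>a. of_bool (P a) - of_bool (P (f a)) :: real"
  have "finite B"
    using assms bij_betw_finite by blast
  have "(\<Sum>a\<in>A. ?d a) = (\<Sum>a\<in>A. of_bool (P a)) - (\<Sum>b\<in>B. of_bool (P b))"
    using sum.reindex_bij_betw[OF f, of "\<lambda>b. of_bool (P b)"] by (simp add: sum_subtractf)
  also have "\<dots> = real (card {a\<in>A. P a}) - real (card {b\<in>B. P b})"
    using \<open>finite A\<close> \<open>finite B\<close> by (simp add: sum_of_bool_eq Int_def)
  finally have diff: "(\<Sum>a\<in>A. ?d a) = real (card {a\<in>A. P a}) - real (card {b\<in>B. P b})" .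
  have "(\<forall>a\<in>A. ?d a \<ge> 0) \<or> (\<forall>a\<in>A. ?d a \<le> 0)"
  proof (rule ccontr)
    assume "\<not> ?thesis"
    then obtain a a' where "a \<in> A" "?d a < 0" "a' \<in> A" "?d a' > 0"
      by (auto simp: not_le)
    \<comment> \<open>The object leaving \<open>P\<close> is \<open>a'\<close>, since its term is
      positive, so it comes first in \<open>dir\<close>.\<close>
    then show False
      using dir[of a' a] by (cases "P a"; cases "P (f a)"; cases "P a'"; cases "P (f a')") auto
  qed
  then have "(\<Sum>a\<in>A. \<bar>?d a\<bar>) = \<bar>\<Sum>a\<in>A. ?d a\<bar>"
  proof
    assume "\<forall>a\<in>A. ?d a \<ge> 0"
    then show ?thesis
      by (simp add: sum_nonneg)
  next
    assume "\<forall>a\<in>A. ?d a \<le> 0"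
    then show ?thesis
      by (simp add: sum_nonpos sum_negf[symmetric])
  qed
  moreover have "(\<Sum>a\<in>A. of_bool (P a \<noteq> P (f a))) = (\<Sum>a\<in>A. \<bar>?d a\<bar>)"
    by (rule sum.cong) auto
  ultimately show ?thesis
    using diff by simp
qed

text \<open>The exchange argument for an abstract family of cuts, free of trees. In
  \<open>noncrossing\<close>, \<open>s\<close> selects the side of \<open>e\<close> on which
  \<open>g\<close> does not separate any two objects.\<close>

lemma optimal_assignment_cost_cut_metric:
  fixes side :: "'e \<Rightarrow> 'a \<Rightarrow> bool" and w :: "'e \<Rightarrow> real"
  assumes "finite E" and w: "\<And>e. e \<in> E \<Longrightarrow> w e > 0"
    and fin: "finite A" "finite B" and card: "card A = card B"
    and c: "\<And>a b. a \<in> A \<Longrightarrow> b \<in> B \<Longrightarrow> c a b = (\<Sum>e\<in>E. w e * of_bool (side e a \<noteq> side e b))"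
    and noncrossing: "\<And>e g. e \<in> E \<Longrightarrow> g \<in> E \<Longrightarrow> e \<noteq> g \<Longrightarrow>
      \<exists>s. \<forall>x\<in>A \<union> B. \<forall>y\<in>A \<union> B. side e x = s \<longrightarrow> side e y = s \<longrightarrow> side g x = side g y"
  shows "optimal_assignment_cost c A B =
    (\<Sum>e\<in>E. w e * \<bar>real (card {a\<in>A. side e a}) - real (card {b\<in>B. side e b})\<bar>)"
proof -
  obtain f where f: "bij_betw f A B"
    and cost_f: "optimal_assignment_cost c A B = (\<Sum>a\<in>A. c a (f a))"
    and opt: "\<And>h. bij_betw h A B \<Longrightarrow> (\<Sum>a\<in>A. c a (f a)) \<le> (\<Sum>a\<in>A. c a (h a))"
    using optimal_assignment_cost_attained[OF fin card, where c = c] by metis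
  have fB: "f a \<in> B" if "a \<in> A" for a
    using f that by (rule bij_betw_apply)
  have one_directional: False
    if e: "e \<in> E" and a: "a \<in> A" "a' \<in> A"
      and sides: "side e a" "\<not> side e (f a)" "\<not> side e a'" "side e (f a')"
    for e a a'
  proof -
    let ?\<delta> = "\<lambda>g x y. of_bool (side g x \<noteq> side g y) :: real"
    let ?old = "\<lambda>g. w g * (?\<delta> g a (f a) + ?\<delta> g a' (f a'))"
    let ?new = "\<lambda>g. w g * (?\<delta> g a (f a') + ?\<delta> g a' (f a))"
    have "?new g \<le> ?old g" if g: "g \<in> E" for g
    proof (cases "g = e")
      case True
      then show ?thesis
        using w[OF g] sides by simp
    next
      case False
      then obtain s where s:
        "\<And>x y. x \<in> A \<union> B \<Longrightarrow> y \<in> A \<union> B \<Longrightarrow> side e x = s \<Longrightarrow> side e y = s \<Longrightarrow> side g x = side g y"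
        using noncrossing[OF e g] by metis
      \<comment> \<open>Each new pair lies within one side of \<open>e\<close>, and the two pairs
        lie on opposite sides. Whichever side \<open>s\<close> is, it contains one of them.\<close>
      have "side g a = side g (f a') \<or> side g a' = side g (f a)"
        using s[of a "f a'"] s[of a' "f a"] sides a fB by (cases s) auto
      \<comment> \<open>If \<open>g\<close> separates the other new pair, the common value of the
        unseparated pair disagrees with one of its members, so \<open>g\<close> separates an old
        pair as well.\<close>
      then have "?\<delta> g a (f a') + ?\<delta> g a' (f a) \<le> ?\<delta> g a (f a) + ?\<delta> g a' (f a')"
        by auto
      then show ?thesis
        using w[OF g] by simp
    qed
    moreover have "?new e < ?old e"
      using w[OF e] sides by simp
    ultimately have "(\<Sum>g\<in>E. ?new g) < (\<Sum>g\<in>E. ?old g)"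
      using \<open>finite E\<close> e by (intro sum_strict_mono_ex1) blast+
    then have "c a (f a') + c a' (f a) < c a (f a) + c a' (f a')"
      using a fB by (simp add: c sum.distrib distrib_left)
    then show False
      using optimal_bij_exchange[where c = c, OF fin(1) f a opt] by simp
  qed
  have "(\<Sum>a\<in>A. c a (f a)) = (\<Sum>a\<in>A. \<Sum>e\<in>E. w e * of_bool (side e a \<noteq> side e (f a)))"
    using fB by (intro sum.cong) (auto simp: c)
  also have "\<dots> = (\<Sum>e\<in>E. w e * (\<Sum>a\<in>A. of_bool (side e a \<noteq> side e (f a))))"
    by (subst sum.swap) (simp add: sum_distrib_left)
  also have "\<dots> = (\<Sum>e\<in>E. w e * \<bar>real (card {a\<in>A. side e a}) - real (card {b\<in>B. side e b})\<bar>)"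
    using one_directional
    by (intro sum.cong refl arg_cong[where f = "(*) (w _)"]
        sum_of_bool_neq_one_directional[OF fin(1) f]) blast
  finally show ?thesis
    using cost_f by simp
qed

section \<open>Walks and paths\<close>

lemma graph_walk_single [simp]:
  "graph_walk V E x [a] y \<longleftrightarrow> a = x \<and> a = y \<and> a \<in> V"
  by (auto simp: graph_walk_def)

lemma graph_walk_Cons_Cons [simp]:
  "graph_walk V E x (a # b # p) y \<longleftrightarrow> a = x \<and> a \<in> V \<and> {a, b} \<in> E \<and> graph_walk V E b (b # p) y"
  by (auto simp: graph_walk_def)

lemma walk_edges_snoc:
  "p \<noteq> [] \<Longrightarrow> walk_edges (p @ [y]) = walk_edges p @ [{last p, y}]"
  by (induction p rule: walk_edges.induct) auto

lemma set_walk_edges_suffix: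
  "set (walk_edges q) \<subseteq> set (walk_edges (p @ q))"
proof (induction p)
  case (Cons a p)
  then show ?case
    by (cases "p @ q") auto
qed simp

lemma walk_edges_subset: "e \<in> set (walk_edges p) \<Longrightarrow> e \<subseteq> set p"
  by (induction p rule: walk_edges.induct) auto

text \<open>Loop removal: if the new first vertex already occurs on the path built for the rest, the
  part of that path from this occurrence on is the required path.\<close>

lemma graph_walk_imp_path:
  "graph_walk V E x p y \<Longrightarrow> \<exists>q. graph_path V E x q y"
proof (induction p arbitrary: x rule: walk_edges.induct)
  case (2 a)
  then show ?case
    by (intro exI[of _ "[a]"]) (auto simp: graph_path_def)
next
  case (3 a b p)
  then obtain q where q: "graph_path V E b q y"
    by auto
  show ?case
  proof (cases "a \<in> set q")
    case True
    then obtain q1 q2 where split: "q = q1 @ a # q2"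
      by (meson split_list)
    have "graph_path V E x (a # q2) y"
      using q 3(2) set_walk_edges_suffix[of "a # q2" q1]
      by (auto simp: graph_path_def graph_walk_def split)
    then show ?thesis ..
  next
    case False
    obtain q' where "q = b # q'"
      using q by (cases q) (auto simp: graph_path_def graph_walk_def)
    then have "graph_path V E x (a # q) y"
      using False q 3(2) by (auto simp: graph_path_def)
    then show ?thesis ..
  qed
qed (simp add: graph_walk_def)

lemma constant_on_walk:
  assumes "p \<noteq> []" "\<And>a b. {a, b} \<in> set (walk_edges p) \<Longrightarrow> P a = P b" "z \<in> set p"
  shows "P z = P (hd p)"
  using assms
proof (induction p rule: walk_edges.induct)
  case (3 a b p)
  have "P a = P b"
    by (rule 3(3)) simp
  moreover have "P z = P (hd (b # p))" if "z \<in> set (b # p)"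
    by (rule 3(1)[OF _ 3(3) that]) simp_all
  ultimately show ?case
    using 3(4) by (cases "z = a") simp_all
qed auto

text \<open>The first vertex of a walk without repetitions lies on its first edge and on no later
  one. The start and the edge set thus determine the second vertex, and removing the first edge from
  both walks leaves the same situation.\<close>

lemma distinct_walk_eq_if_edges_eq:
  assumes "distinct p" "distinct q" "p \<noteq> []" "q \<noteq> []" "hd p = hd q"
    and "set (walk_edges p) = set (walk_edges q)"
  shows "p = q"
  using assms
proof (induction p arbitrary: q rule: walk_edges.induct)
  case (2 a)
  then show ?case
    by (cases q rule: walk_edges.cases) auto
next
  case (3 a b p)
  then obtain d r where q: "q = a # d # r"
    by (cases q rule: walk_edges.cases) auto
  have notin: "{a, x} \<notin> set (walk_edges (b # p))" "{a, x} \<notin> set (walk_edges (d # r))" for x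
    using walk_edges_subset[of "{a, x}" "b # p"] walk_edges_subset[of "{a, x}" "d # r"] 3(2,3) q
    by auto
  have eq: "insert {a, b} (set (walk_edges (b # p))) = insert {a, d} (set (walk_edges (d # r)))"
    using 3(7) q by simp
  then have "{a, b} = {a, d}"
    using notin by blast
  then have "b = d"
    by (auto simp: doubleton_eq_iff)
  moreover have "set (walk_edges (b # p)) = set (walk_edges (d # r))"
    using eq notin \<open>b = d\<close> by (metis insert_ident)
  ultimately show ?case
    using 3(1)[of "d # r"] 3(2,3) q by simp
qed simp

lemma component_of_vertex_edge_closed:
  assumes "x \<in> component_of_vertex V F u" "y \<in> V" "{x, y} \<in> F"
  shows "y \<in> component_of_vertex V F u"
proof -
  obtain p where "graph_walk V F u p x"
    using assms by (auto simp: component_of_vertex_def)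
  then have "graph_walk V F u (p @ [y]) y"
    using assms by (auto simp: graph_walk_def walk_edges_snoc)
  then show ?thesis
    using assms by (auto simp: component_of_vertex_def)
qed

section \<open>Edge cuts of a tree\<close>

locale oriented_tree =
  fixes V :: "'v set" and E :: "'v set set" and ends :: "'v set \<Rightarrow> 'v \<times> 'v"
  assumes tree: "finite_tree V E" and ordering: "endpoint_ordering E ends"
begin

text \<open>Truth values make separation by \<open>e\<close> the inequality
  \<open>side e x \<noteq> side e y\<close>; \<open>left_count\<close> counts the objects whose
  vertex has value \<open>True\<close>.\<close>

definition side :: "'v set \<Rightarrow> 'v \<Rightarrow> bool" where
  "side e x \<longleftrightarrow> x \<in> component_of_vertex V (E - {e}) (fst (ends e))"

lemma edge_vertices: "{x, y} \<in> E \<Longrightarrow> x \<in> V \<and> y \<in> V \<and> x \<noteq> y"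
  using tree unfolding finite_tree_def finite_simple_graph_def
  by (fastforce simp: doubleton_eq_iff)

lemma edges_subset_Pow: "E \<subseteq> Pow V"
  using tree by (fastforce simp: finite_tree_def finite_simple_graph_def)

lemma finite_edges: "finite E"
proof (rule finite_subset[OF edges_subset_Pow])
  show "finite (Pow V)"
    using tree by (simp add: finite_tree_def finite_simple_graph_def)
qed

text \<open>A path from \<open>u\<close> to \<open>v\<close> avoiding the edge would close up with
  it to a cycle.\<close>

lemma edge_is_bridge:
  assumes e: "{u, v} \<in> E"
  shows "v \<notin> component_of_vertex V (E - {{u, v}}) u"
proof
  assume "v \<in> component_of_vertex V (E - {{u, v}}) u"
  then obtain p where p: "graph_path V (E - {{u, v}}) u p v"
    using graph_walk_imp_path by (fastforce simp: component_of_vertex_def)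
  have "u \<noteq> v"
    using edge_vertices[OF e] by simp
  \<comment> \<open>One vertex would force \<open>u = v\<close>; two would make the deleted edge
    itself the path.\<close>
  then have "length p \<ge> 3"
    using p by (cases p rule: walk_edges.cases; cases "tl (tl p)")
      (auto simp: graph_path_def graph_walk_def)
  moreover have "graph_walk V E u (p @ [u]) u"
    using p e by (auto simp: graph_path_def graph_walk_def walk_edges_snoc insert_commute)
  moreover have "hd p = u" "distinct p"
    using p by (auto simp: graph_path_def graph_walk_def)
  ultimately have "graph_cycle V E p"
    by (simp add: graph_cycle_def)
  then show False
    using tree by (auto simp: finite_tree_def)
qed

text \<open>The edge survives the deletion of \<open>e\<close> and can be walked in both directions,
  so a component contains both endpoints or neither.\<close>

lemma side_other_edge:
  assumes "{x, y} \<in> E" "{x, y} \<noteq> e"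
  shows "side e x = side e y"
proof -
  have "x \<in> V" "y \<in> V" "{x, y} \<in> E - {e}" "{y, x} \<in> E - {e}"
    using assms edge_vertices[OF assms(1)] by (simp_all add: insert_commute)
  then show ?thesis
    unfolding side_def by (blast intro: component_of_vertex_edge_closed)
qed

lemma side_own_edge:
  assumes e: "{x, y} \<in> E"
  shows "side {x, y} x \<noteq> side {x, y} y"
proof -
  obtain u v where uv: "ends {x, y} = (u, v)"
    by fastforce
  then have eq: "{x, y} = {u, v}"
    using ordering e unfolding endpoint_ordering_def by (metis fst_conv snd_conv)
  have "u \<in> V"
    using edge_vertices e eq by metis
  then have "u \<in> component_of_vertex V (E - {{x, y}}) u"
    unfolding component_of_vertex_def by (auto intro!: exI[of _ "[u]"])
  then have "side {x, y} u"
    using uv by (simp add: side_def)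
  moreover have "\<not> side {x, y} v"
    using edge_is_bridge[of u v] e eq uv by (simp add: side_def)
  \<comment> \<open>\<open>ends\<close> may list the endpoints as \<open>x\<close>, \<open>y\<close>
    or as \<open>y\<close>, \<open>x\<close>; the claim is symmetric in them.\<close>
  ultimately show ?thesis
    using eq by (metis doubleton_eq_iff)
qed

text \<open>Walking along an edge changes the side with respect to that edge and no other. A path
  uses each of its edges once, so exactly these edges separate its ends.\<close>

lemma path_edges_eq_separating_edges:
  "graph_path V E x p y \<Longrightarrow> set (walk_edges p) = {e\<in>E. side e x \<noteq> side e y}"
proof (induction p arbitrary: x rule: walk_edges.induct)
  case (3 a b p)
  then have ab: "a = x" "{a, b} \<in> E" and path: "graph_path V E b (b # p) y" and "a \<notin> set (b # p)"
    by (auto simp: graph_path_def)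
  then have "{a, b} \<notin> set (walk_edges (b # p))"
    using walk_edges_subset by blast
  moreover have IH: "set (walk_edges (b # p)) = {e\<in>E. side e b \<noteq> side e y}"
    using 3(1) path by blast
  \<comment> \<open>The first edge does not recur on the rest of the path, so by induction it does
    not separate \<open>b\<close> from \<open>y\<close>.\<close>
  ultimately have "side {a, b} b = side {a, b} y"
    using ab by blast
  then have "side {a, b} a \<noteq> side {a, b} y"
    using side_own_edge[OF ab(2)] by simp
  moreover have "side e a = side e b" if "e \<noteq> {a, b}" for e
    using side_other_edge[OF ab(2)] that by metis
  ultimately have "e \<in> set (walk_edges (a # b # p)) \<longleftrightarrow> e \<in> E \<and> side e a \<noteq> side e y" for e
    using IH ab by (cases "e = {a, b}") simp_all
  then show ?case
    using ab(1) by blast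
qed (auto simp: graph_path_def graph_walk_def)

section \<open>The tree metric as a sum over noncrossing edge cuts\<close>

lemma path_exists:
  assumes "x \<in> V" "y \<in> V"
  obtains p where "graph_path V E x p y"
proof -
  obtain p where "graph_walk V E x p y"
    using assms tree unfolding finite_tree_def graph_connected_def by blast
  then show ?thesis
    using graph_walk_imp_path that by metis
qed

text \<open>Both edge sets consist of the edges separating \<open>x\<close> from \<open>y\<close>,
  so no cycle has to be built from two different paths. This justifies the \<open>THE\<close> in
  \<open>tree_path\<close>.\<close>

lemma path_unique:
  assumes "graph_path V E x p y" "graph_path V E x q y"
  shows "p = q"
proof (rule distinct_walk_eq_if_edges_eq)
  show "set (walk_edges p) = set (walk_edges q)"
    using assms[THEN path_edges_eq_separating_edges] by simp
qed (use assms in \<open>simp_all add: graph_path_def graph_walk_def\<close>)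

lemma tree_dist_eq_sum_separating:
  assumes "x \<in> V" "y \<in> V"
  shows "tree_dist V E w x y = (\<Sum>e\<in>E. w e * of_bool (side e x \<noteq> side e y))"
proof -
  obtain p where p: "graph_path V E x p y"
    using path_exists[OF assms] .
  then have "tree_path V E x y = p"
    unfolding tree_path_def using path_unique by blast
  then have "tree_dist V E w x y = (\<Sum>e\<in>{e\<in>E. side e x \<noteq> side e y}. w e)"
    using path_edges_eq_separating_edges[OF p] by (simp add: tree_dist_def)
  also have "\<dots> = (\<Sum>e\<in>E. w e * of_bool (side e x \<noteq> side e y))"
    using finite_edges by (intro sum.mono_neutral_cong_left) auto
  finally show ?thesis .
qed

text \<open>The witness is the side of \<open>e\<close> that does not contain the endpoint
  \<open>a\<close> of \<open>g\<close>. If \<open>g\<close> separated two vertices there, their path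
  would run through \<open>a\<close>; but \<open>e\<close> does not separate them, so the path
  avoids \<open>e\<close> and cannot leave that side.\<close>

lemma sides_noncrossing:
  assumes "g \<in> E" "e \<noteq> g"
  shows "\<exists>s. \<forall>x\<in>V. \<forall>y\<in>V. side e x = s \<longrightarrow> side e y = s \<longrightarrow> side g x = side g y"
proof -
  obtain a b where g: "g = {a, b}"
    using assms ordering by (auto simp: endpoint_ordering_def)
  have "side g x = side g y"
    if xy: "x \<in> V" "y \<in> V" and sides: "side e x = (\<not> side e a)" "side e y = (\<not> side e a)" for x y
  proof (rule ccontr)
    assume sep: "side g x \<noteq> side g y"
    obtain p where p: "graph_path V E x p y"
      using path_exists[OF xy] .
    note edges = path_edges_eq_separating_edges[OF p]
    have "g \<in> set (walk_edges p)"
      using sep assms edges by simp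
    then have "a \<in> set p"
      using walk_edges_subset g by fast
    have const: "side e a' = side e b'" if "{a', b'} \<in> set (walk_edges p)" for a' b'
    proof (rule side_other_edge)
      show "{a', b'} \<in> E" "{a', b'} \<noteq> e"
        using that edges sides by auto
    qed
    have "side e a = side e (hd p)"
      by (rule constant_on_walk[OF _ const \<open>a \<in> set p\<close>]) (use \<open>a \<in> set p\<close> in auto)
    moreover have "hd p = x"
      using p by (simp add: graph_path_def graph_walk_def)
    ultimately show False
      using sides by simp
  qed
  then show ?thesis
    by blast
qed

end

theorem theorem5:
  fixes D :: "nat \<Rightarrow> 'a set" and k :: nat and \<D> :: "'a set set"
    and c :: "'a \<Rightarrow> 'a \<Rightarrow> real"
    and V :: "'v set" and E :: "'v set set" and w :: "'v set \<Rightarrow> real"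
    and ends :: "'v set \<Rightarrow> 'v \<times> 'v" and \<rho> :: "'a \<Rightarrow> 'v"
  assumes dataset: "\<D> = D ` {1..k}"
    and finite_sets: "\<And>i. i \<in> {1..k} \<Longrightarrow> finite (D i)"
    and equal_card: "\<And>i j. i \<in> {1..k} \<Longrightarrow> j \<in> {1..k} \<Longrightarrow> card (D i) = card (D j)"
    and tree: "finite_tree V E"
    and weights_pos: "\<And>e. e \<in> E \<Longrightarrow> w e > 0"
    and ordering: "endpoint_ordering E ends"
    and map_to_vertices: "\<rho> \<in> \<Union>\<D> \<rightarrow> V"
    and cost: "\<And>a b. a \<in> \<Union>\<D> \<Longrightarrow> b \<in> \<Union>\<D> \<Longrightarrow> c a b = tree_dist V E w (\<rho> a) (\<rho> b)"
  shows "\<forall>A\<in>\<D>. \<forall>B\<in>\<D>.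
    optimal_assignment_cost c A B =
      l1_norm_on E (\<lambda>e. tree_embedding V E w ends \<rho> A e - tree_embedding V E w ends \<rho> B e)"
proof (intro ballI)
  fix A B
  assume AB: "A \<in> \<D>" "B \<in> \<D>"
  interpret oriented_tree V E ends
    using tree ordering by unfold_locales
  \<comment> \<open>The cuts are pulled back along \<open>\<rho>\<close> to objects, so several
    objects may sit at one vertex.\<close>
  let ?side = "\<lambda>e a. side e (\<rho> a)"
  have fin: "finite A" "finite B" and card: "card A = card B"
    using AB finite_sets unfolding dataset by (auto intro: equal_card)
  have \<rho>: "\<rho> a \<in> V" if "a \<in> A \<union> B" for a
    using map_to_vertices AB that by blast
  have "optimal_assignment_cost c A B =
      (\<Sum>e\<in>E. w e * \<bar>real (card {a\<in>A. ?side e a}) - real (card {b\<in>B. ?side e b})\<bar>)"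
  proof (rule optimal_assignment_cost_cut_metric[OF finite_edges weights_pos fin card])
    fix a b
    assume "a \<in> A" "b \<in> B"
    then show "c a b = (\<Sum>e\<in>E. w e * of_bool (?side e a \<noteq> ?side e b))"
      using cost[of a b] AB tree_dist_eq_sum_separating[of "\<rho> a" "\<rho> b"] \<rho>[of a] \<rho>[of b] by auto
  next
    fix e g
    assume "e \<in> E" "g \<in> E" "e \<noteq> g"
    then obtain s where
      s: "\<forall>x\<in>V. \<forall>y\<in>V. side e x = s \<longrightarrow> side e y = s \<longrightarrow> side g x = side g y"
      using sides_noncrossing by metis
    show "\<exists>s. \<forall>x\<in>A \<union> B. \<forall>y\<in>A \<union> B. ?side e x = s \<longrightarrow> ?side e y = s \<longrightarrow> ?side g x = ?side g y"
    proof (intro exI ballI impI)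
      fix x y
      assume "x \<in> A \<union> B" "y \<in> A \<union> B" "?side e x = s" "?side e y = s"
      then show "?side g x = ?side g y"
        using s[rule_format, OF \<rho> \<rho>] by blast
    qed
  qed
  also have "\<dots> =
      l1_norm_on E (\<lambda>e. tree_embedding V E w ends \<rho> A e - tree_embedding V E w ends \<rho> B e)"
    unfolding l1_norm_on_def
  proof (rule sum.cong)
    fix e
    assume "e \<in> E"
    \<comment> \<open>Positivity of \<open>w e\<close> lets the weight move inside the absolute
      value.\<close>
    then show "w e * \<bar>real (card {a\<in>A. ?side e a}) - real (card {b\<in>B. ?side e b})\<bar> =
        \<bar>tree_embedding V E w ends \<rho> A e - tree_embedding V E w ends \<rho> B e\<bar>"
      using weights_pos[of e]
      by (simp add: tree_embedding_def left_count_def side_def abs_mult flip: left_diff_distrib)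
  qed simp
  finally show "optimal_assignment_cost c A B =
      l1_norm_on E (\<lambda>e. tree_embedding V E w ends \<rho> A e - tree_embedding V E w ends \<rho> B e)" .
qed

end
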